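(* Let $\mathcal{D}=\{(\rho,\theta)\in\mathbb{R}^2:\rho>0,\theta>0\}$, let $\tau>0$ be a constant, and let $p,e,\lambda,\mu,\kappa\in C^\infty(\mathcal{D};\mathbb{R})$ satisfy, on all of $\mathcal{D}$, $\mu\ge0$, $\tfrac23\mu+\lambda\ge0$, $\kappa>0$, $p>0$, $p_\rho>0$, $p_\theta>0$, $e_\theta>0$; put $\nu:=2\mu+\lambda$. Let $\mathcal{U}:=\{(\rho,u,\theta,q)^\top\in\mathbb{R}^4:\rho>0,\theta>0\}$. Then the Cattaneo-Christov system $$A^0(U)U_t+A^1(U)U_x=B(U)U_{xx}+Q(U)+G(U,U_x),\qquad U=(\rho,u,\theta,q)^\top\in\mathcal{U},$$ with coefficients given in the context, is symmetrizable, with symmetrizer $S\in C^\infty(\mathcal{U};\mathbb{R}^{4\times4})$ given by $$S(U)=\begin{pmatrix} \frac{p_\rho}{\rho} & 0 & 0 & 0 \\ 0 & 1 & 0 & 0 \\ 0 & 0 & \frac1\theta & 0 \\ 0 & 0 & 0 & \frac{1}{\kappa\theta} \end{pmatrix},\qquad U\in\mathcal{U}.$$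
   Context: Subscripts $\rho,\theta$ denote partial derivatives; $p$ is the pressure, $e$ the internal energy density, $\kappa$ the heat conductivity, $\lambda,\mu$ viscosity coefficients, all evaluated at $(\rho,\theta)$. The coefficients are $$A^0(U)=\mathrm{diag}(1,\rho,\rho e_\theta,\tau),\qquad A^1(U)=\begin{pmatrix} u & \rho & 0 & 0 \\ {p_\rho} & \rho u & p_\theta & 0 \\ 0 & \theta p_\theta & \rho u e_\theta & 1 \\ 0 & 0 & \kappa & \tau u \end{pmatrix},$$ $$B(U)=\mathrm{diag}(0,\nu,0,0),\qquad Q(U)=(0,0,0,-q)^\top,\qquad G(U,U_x)=(0,\nu_xu_x,\nu u_x^2,0)^\top,$$ and $D(U):=d_UQ(U)=\mathrm{diag}(0,0,0,-1)$ is the Jacobian of $Q$. Definition: a system of this form is symmetrizable if there exists $S\in C^\infty(\mathcal{U};\mathbb{R}^{4\times4})$, with $S(U)$ symmetric and positive definite, such that $S(U)A^0(U)$, $S(U)A^1(U)$, $S(U)B(U)$ and $S(U)D(U)$ are symmetric for all $U\in\mathcal{U}$; such an $S$ is called a symmetrizer. *)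

theory Defs
  imports "HOL-Analysis.Analysis"
begin

text \<open>
  \<^term>\<open>Ck_on n f X\<close> is meant for open \<open>X\<close>: the function and all its iterated directional
  derivatives up to order \<open>n\<close>, in arbitrary directions, exist (as Frechet derivatives) and are
  continuous on \<open>X\<close>. It depends only on the values of \<open>f\<close> on \<open>X\<close>.
\<close>

primrec Ck_on ::
  "nat \<Rightarrow> ('a::real_normed_vector \<Rightarrow> 'b::real_normed_vector) \<Rightarrow> 'a set \<Rightarrow> bool"
where
  "Ck_on 0 f X \<longleftrightarrow> continuous_on X f"
| "Ck_on (Suc n) f X \<longleftrightarrow>
     (\<forall>x\<in>X. f differentiable (at x)) \<and>
     (\<forall>v. Ck_on n (\<lambda>x. frechet_derivative f (at x) v) X)"

definition smooth_on ::
  "('a::real_normed_vector \<Rightarrow> 'b::real_normed_vector) \<Rightarrow> 'a set \<Rightarrow> bool"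
where
  "smooth_on f X \<longleftrightarrow> (\<forall>n. Ck_on n f X)"

definition symmetric_matrix :: "real^'n^'n \<Rightarrow> bool" where
  "symmetric_matrix M \<longleftrightarrow> transpose M = M"

definition positive_definite :: "real^'n^'n \<Rightarrow> bool" where
  "positive_definite M \<longleftrightarrow> (\<forall>x. x \<noteq> 0 \<longrightarrow> 0 < x \<bullet> (M *v x))"

text \<open>
  A first-order-in-time system
    \<open>A0(U) U_t + A1(U) U_x = B(U) U_xx + Q(U) + G(U, U_x)\<close>
  for states \<open>U\<close> in the given set; the second argument of \<open>Gfun\<close> stands for \<open>U_x\<close>.
\<close>

record system4 =
  states :: "(real^4) set"
  A0mat :: "real^4 \<Rightarrow> real^4^4"
  A1mat :: "real^4 \<Rightarrow> real^4^4"
  Bmat :: "real^4 \<Rightarrow> real^4^4"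
  Qfun :: "real^4 \<Rightarrow> real^4"
  Gfun :: "real^4 \<Rightarrow> real^4 \<Rightarrow> real^4"

definition Dmat :: "system4 \<Rightarrow> real^4 \<Rightarrow> real^4^4" where
  "Dmat sys U = jacobian (Qfun sys) (at U)"

definition is_symmetrizer :: "system4 \<Rightarrow> (real^4 \<Rightarrow> real^4^4) \<Rightarrow> bool" where
  "is_symmetrizer sys S \<longleftrightarrow>
     smooth_on S (states sys) \<and>
     (\<forall>U\<in>states sys.
        symmetric_matrix (S U) \<and> positive_definite (S U) \<and>
        symmetric_matrix (S U ** A0mat sys U) \<and>
        symmetric_matrix (S U ** A1mat sys U) \<and>
        symmetric_matrix (S U ** Bmat sys U) \<and>
        symmetric_matrix (S U ** Dmat sys U))"

definition symmetrizable :: "system4 \<Rightarrow> bool" where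
  "symmetrizable sys \<longleftrightarrow> (\<exists>S. is_symmetrizer sys S)"

text \<open>Thermodynamic functions take the pair \<open>(\<rho>, \<theta>)\<close>.\<close>

definition thermo_domain :: "(real \<times> real) set" where
  "thermo_domain = {(\<rho>, \<theta>). \<rho> > 0 \<and> \<theta> > 0}"

definition d_rho :: "(real \<times> real \<Rightarrow> real) \<Rightarrow> real \<times> real \<Rightarrow> real" where
  "d_rho f = (\<lambda>(\<rho>, \<theta>). deriv (\<lambda>r. f (r, \<theta>)) \<rho>)"

definition d_theta :: "(real \<times> real \<Rightarrow> real) \<Rightarrow> real \<times> real \<Rightarrow> real" where
  "d_theta f = (\<lambda>(\<rho>, \<theta>). deriv (\<lambda>t. f (\<rho>, t)) \<theta>)"

text \<open>
  The components of the state \<open>U = (\<rho>, u, \<theta>, q)\<close> are \<open>U $ 1, \<dots>, U $ 4\<close>. In the source term \<open>G\<close>,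
  \<open>\<nu>_x\<close> is the derivative of \<open>x \<mapsto> \<nu>(\<rho>(x), \<theta>(x))\<close>, expanded by the chain rule.
\<close>

definition cattaneo_christov ::
  "real \<Rightarrow> (real \<times> real \<Rightarrow> real) \<Rightarrow> (real \<times> real \<Rightarrow> real) \<Rightarrow> (real \<times> real \<Rightarrow> real) \<Rightarrow>
   (real \<times> real \<Rightarrow> real) \<Rightarrow> (real \<times> real \<Rightarrow> real) \<Rightarrow> system4"
where
  "cattaneo_christov \<tau> p e lam \<mu> \<kappa> =
     (let \<nu> = (\<lambda>z. 2 * \<mu> z + lam z) in
      \<lparr> states = {U. U $ 1 > 0 \<and> U $ 3 > 0},
        A0mat = (\<lambda>U. let \<rho> = U $ 1; \<theta> = U $ 3 in
          vector [vector [1, 0, 0, 0],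
                  vector [0, \<rho>, 0, 0],
                  vector [0, 0, \<rho> * d_theta e (\<rho>, \<theta>), 0],
                  vector [0, 0, 0, \<tau>]]),
        A1mat = (\<lambda>U. let \<rho> = U $ 1; u = U $ 2; \<theta> = U $ 3 in
          vector [vector [u, \<rho>, 0, 0],
                  vector [d_rho p (\<rho>, \<theta>), \<rho> * u, d_theta p (\<rho>, \<theta>), 0],
                  vector [0, \<theta> * d_theta p (\<rho>, \<theta>), \<rho> * u * d_theta e (\<rho>, \<theta>), 1],
                  vector [0, 0, \<kappa> (\<rho>, \<theta>), \<tau> * u]]),
        Bmat = (\<lambda>U. let \<rho> = U $ 1; \<theta> = U $ 3 in
          vector [vector [0, 0, 0, 0],
                  vector [0, \<nu> (\<rho>, \<theta>), 0, 0],
                  vector [0, 0, 0, 0],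
                  vector [0, 0, 0, 0]]),
        Qfun = (\<lambda>U. vector [0, 0, 0, - (U $ 4)]),
        Gfun = (\<lambda>U Ux. let \<rho> = U $ 1; \<theta> = U $ 3;
            \<rho>x = Ux $ 1; ux = Ux $ 2; \<theta>x = Ux $ 3;
            \<nu>x = d_rho \<nu> (\<rho>, \<theta>) * \<rho>x + d_theta \<nu> (\<rho>, \<theta>) * \<theta>x in
          vector [0, \<nu>x * ux, \<nu> (\<rho>, \<theta>) * ux\<^sup>2, 0]) \<rparr>)"

definition cc_symmetrizer ::
  "(real \<times> real \<Rightarrow> real) \<Rightarrow> (real \<times> real \<Rightarrow> real) \<Rightarrow> real^4 \<Rightarrow> real^4^4"
where
  "cc_symmetrizer p \<kappa> U =
     (let \<rho> = U $ 1; \<theta> = U $ 3 in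
      vector [vector [d_rho p (\<rho>, \<theta>) / \<rho>, 0, 0, 0],
              vector [0, 1, 0, 0],
              vector [0, 0, 1 / \<theta>, 0],
              vector [0, 0, 0, 1 / (\<kappa> (\<rho>, \<theta>) * \<theta>)]])"

end

theory Submission
  imports Defs
begin

section \<open>Calculus of \<open>C\<^sup>k\<close> functions\<close>

text \<open>A diagonal \<open>S\<close> multiplies each row by a scalar, so \<open>S U\<close> stays
  diagonal, hence symmetric, after multiplication by the diagonal matrices \<open>A0mat\<close>,
  \<open>Bmat\<close> and \<open>Dmat\<close>. In \<open>A1mat\<close> the nonzero off-diagonal
  entries lie in the three mirror pairs next to the diagonal, and the row weights equalize each
  pair: with weights p_rho/\<rho>, 1, 1/\<theta>, 1/(\<kappa>\<theta>) the common values become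
  p_rho, p_theta and 1/\<theta>. Positivity of \<rho>, \<theta>, \<kappa> and p_rho makes the
  weights positive, so \<open>S U\<close> is positive definite
  (\<open>positive_definite_diagonal\<close>).

  The longer part is smoothness of \<open>S\<close>. The class \<open>Ck_on n\<close> is shown to be
  closed under products, inverses and composition with bounded linear maps, by induction on
  \<open>n\<close> via the usual differentiation rules. The entries of \<open>S\<close> are
  quotients of smooth functions pulled back along the projection U \<mapsto> (\<rho>, \<theta>);
  \<open>Ck_on_d_rho\<close> handles p_rho, and \<open>Ck_on_vec\<close> passes from entries to the
  matrix.\<close>

lemma frechet_derivative_eqI:
  assumes "(f has_derivative f') (at x)"
  shows "frechet_derivative f (at x) = f'"
  using frechet_derivative_at[OF assms] by simp

lemma Ck_on_continuous_on:
  assumes "Ck_on n f X"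
  shows "continuous_on X f"
proof (cases n)
  case (Suc m)
  then have "continuous (at x) f" if "x \<in> X" for x
    using assms that by (auto intro: differentiable_imp_continuous_within)
  then show ?thesis
    by (simp add: continuous_at_imp_continuous_on)
qed (use assms in simp)

text \<open>Needed in the inductions below: the Leibniz rule leaves one factor undifferentiated,
  known to order \<open>Suc n\<close> but used at order \<open>n\<close>.\<close>

lemma Ck_on_Suc_imp: "Ck_on (Suc n) f X \<Longrightarrow> Ck_on n f X"
proof (induction n arbitrary: f)
  case 0
  then show ?case using Ck_on_continuous_on[of "Suc 0" f X] by simp
next
  case (Suc n)
  from Suc.prems have "Ck_on (Suc n) (\<lambda>x. frechet_derivative f (at x) v) X" for v
    by simp
  then have "Ck_on n (\<lambda>x. frechet_derivative f (at x) v) X" for v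
    by (rule Suc.IH)
  with Suc.prems show ?case by simp
qed

text \<open>Openness is essential: \<open>frechet_derivative\<close> at \<open>x\<close> sees a full
  neighbourhood of \<open>x\<close>, on which the two functions must agree.\<close>

lemma Ck_on_cong:
  assumes "open X" "\<And>x. x \<in> X \<Longrightarrow> f x = g x" "Ck_on n f X"
  shows "Ck_on n g X"
  using assms(2,3)
proof (induction n arbitrary: f g)
  case 0
  then show ?case by (metis Ck_on.simps(1) continuous_on_cong)
next
  case (Suc n)
  have der: "(g has_derivative frechet_derivative f (at x)) (at x)" if "x \<in> X" for x
  proof (rule has_derivative_transform_within_open[OF _ assms(1) that])
    show "(f has_derivative frechet_derivative f (at x)) (at x)"
      using Suc.prems(2) that by (simp add: frechet_derivative_works)
  qed (use Suc.prems(1) in auto)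
  have "Ck_on n (\<lambda>x. frechet_derivative g (at x) v) X" for v
  proof (rule Suc.IH)
    show "Ck_on n (\<lambda>x. frechet_derivative f (at x) v) X"
      using Suc.prems(2) by simp
  qed (simp add: frechet_derivative_eqI[OF der])
  with der show ?case by (auto simp: differentiable_def)
qed

text \<open>The induction step for all closure rules: an explicit derivative \<open>f'\<close> may
  replace the chosen \<open>frechet_derivative\<close>, because Frechet derivatives are
  unique.\<close>

lemma Ck_on_SucI:
  assumes "open X"
    and der: "\<And>x. x \<in> X \<Longrightarrow> (f has_derivative f' x) (at x)"
    and "\<And>v. Ck_on n (\<lambda>x. f' x v) X"
  shows "Ck_on (Suc n) f X"
proof -
  have "Ck_on n (\<lambda>x. frechet_derivative f (at x) v) X" for v
    using assms(1) _ assms(3)[of v]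
    by (rule Ck_on_cong) (simp add: frechet_derivative_eqI[OF der])
  with der show ?thesis by (auto simp: differentiable_def)
qed

lemma Ck_on_SucD:
  assumes "Ck_on (Suc n) f X" "x \<in> X"
  shows "(f has_derivative frechet_derivative f (at x)) (at x)"
  using assms by (simp add: frechet_derivative_works)

lemma Ck_on_const:
  assumes "open X"
  shows "Ck_on n (\<lambda>x. c) X"
proof (induction n arbitrary: c)
  case (Suc n)
  show ?case
    by (rule Ck_on_SucI[OF assms has_derivative_const]) (rule Suc.IH)
qed simp

lemma Ck_on_bounded_linear:
  assumes "open X" "bounded_linear L"
  shows "Ck_on n L X"
proof (cases n)
  case 0
  then show ?thesis using assms(2) by (simp add: linear_continuous_on)
next
  case (Suc m)
  have "Ck_on (Suc m) L X"
    \<comment> \<open>The derivative of \<open>L\<close> is \<open>L\<close> at every point, so each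
      directional derivative \<open>L v\<close> is constant.\<close>
    by (rule Ck_on_SucI[OF assms(1) bounded_linear_imp_has_derivative[OF assms(2)]])
      (rule Ck_on_const[OF assms(1)])
  with Suc show ?thesis by simp
qed

lemma Ck_on_add:
  assumes "open X" "Ck_on n f X" "Ck_on n g X"
  shows "Ck_on n (\<lambda>x. f x + g x) X"
  using assms(2,3)
proof (induction n arbitrary: f g)
  case 0
  then show ?case by (simp add: continuous_on_add)
next
  case (Suc n)
  show ?case
    by (rule Ck_on_SucI[OF assms(1) has_derivative_add
          [OF Ck_on_SucD[OF Suc.prems(1)] Ck_on_SucD[OF Suc.prems(2)]]])
      (use Suc in auto)
qed

text \<open>By the Leibniz rule the derivative is a sum of two products of the same kind, so the
  induction generalizes over both factors.\<close>

lemma Ck_on_bounded_bilinear: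
  assumes "bounded_bilinear prd" "open X" "Ck_on n f X" "Ck_on n g X"
  shows "Ck_on n (\<lambda>x. prd (f x) (g x)) X"
  using assms(3,4)
proof (induction n arbitrary: f g)
  case 0
  then show ?case using assms(1) by (simp add: bounded_bilinear.continuous_on)
next
  case (Suc n)
  show ?case
  proof (rule Ck_on_SucI[OF assms(2) bounded_bilinear.FDERIV
        [OF assms(1) Ck_on_SucD[OF Suc.prems(1)] Ck_on_SucD[OF Suc.prems(2)]]])
    fix v
    show "Ck_on n (\<lambda>x. prd (f x) (frechet_derivative g (at x) v) +
        prd (frechet_derivative f (at x) v) (g x)) X"
      by (intro Ck_on_add assms(2) Suc.IH)
        (use Suc.prems Ck_on_Suc_imp in auto)
  qed
qed

lemmas Ck_on_mult = Ck_on_bounded_bilinear[OF bounded_bilinear_mult]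

lemma Ck_on_inverse:
  fixes f :: "'a::real_normed_vector \<Rightarrow> 'b::real_normed_div_algebra"
  assumes "open X" "\<And>x. x \<in> X \<Longrightarrow> f x \<noteq> 0" "Ck_on n f X"
  shows "Ck_on n (\<lambda>x. inverse (f x)) X"
  using assms(3)
proof (induction n)
  case 0
  then show ?case using assms(2) by (simp add: continuous_on_inverse)
next
  case (Suc n)
  show ?case
  proof (rule Ck_on_SucI[OF assms(1) Deriv.has_derivative_inverse
        [OF assms(2) Ck_on_SucD[OF Suc.prems]]])
    fix v
    \<comment> \<open>The derivative of the inverse contains only the inverse itself, covered by the
      induction hypothesis, and a derivative of \<open>f\<close>. The sign is written as a constant
      factor so that the product rule applies.\<close>
    have "Ck_on n (\<lambda>x. (- 1) * (inverse (f x) * frechet_derivative f (at x) v * inverse (f x))) X"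
      by (intro Ck_on_mult assms(1) Ck_on_const Suc.IH)
        (use Suc.prems Ck_on_Suc_imp in auto)
    then show "Ck_on n (\<lambda>x. - (inverse (f x) * frechet_derivative f (at x) v * inverse (f x))) X"
      by simp
  qed
qed

lemma Ck_on_divide:
  fixes f g :: "'a::real_normed_vector \<Rightarrow> 'b::real_normed_field"
  assumes "open X" "\<And>x. x \<in> X \<Longrightarrow> g x \<noteq> 0" "Ck_on n f X" "Ck_on n g X"
  shows "Ck_on n (\<lambda>x. f x / g x) X"
  unfolding divide_inverse
  by (intro Ck_on_mult Ck_on_inverse assms)

text \<open>For a linear inner map the chain rule keeps the shape: the derivative in direction
  \<open>v\<close> is the derivative of \<open>f\<close> in direction \<open>L v\<close>, again
  composed with \<open>L\<close>. No product terms arise.\<close>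

lemma Ck_on_compose_bounded_linear:
  assumes "open X" "bounded_linear L" "L ` X \<subseteq> Y" "Ck_on n f Y"
  shows "Ck_on n (\<lambda>x. f (L x)) X"
  using assms(4)
proof (induction n arbitrary: f)
  case 0
  then show ?case
    using continuous_on_compose2[of Y f X L] assms(2,3) by (simp add: linear_continuous_on)
next
  case (Suc n)
  show ?case
  proof (rule Ck_on_SucI[OF assms(1)])
    fix x assume "x \<in> X"
    then have "(f has_derivative frechet_derivative f (at (L x))) (at (L x))"
      using Ck_on_SucD[OF Suc.prems] assms(3) by blast
    with bounded_linear_imp_has_derivative[OF assms(2)]
    show "((\<lambda>x. f (L x)) has_derivative (\<lambda>v. frechet_derivative f (at (L x)) (L v))) (at x)"
      by (rule has_derivative_compose)
  next
    fix v
    show "Ck_on n (\<lambda>x. frechet_derivative f (at (L x)) (L v)) X"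
      using Suc.prems by (intro Suc.IH) simp
  qed
qed

lemma Ck_on_sum:
  assumes "open X" "\<And>i. i \<in> I \<Longrightarrow> Ck_on n (f i) X"
  shows "Ck_on n (\<lambda>x. \<Sum>i\<in>I. f i x) X"
  using assms(2)
  by (induction I rule: infinite_finite_induct)
    (auto intro!: Ck_on_add Ck_on_const assms(1))

lemma Ck_on_compose_bounded_linear_left:
  assumes "open X" "bounded_linear L" "Ck_on n f X"
  shows "Ck_on n (\<lambda>x. L (f x)) X"
  using assms(3)
proof (induction n arbitrary: f)
  case 0
  then show ?case
    using assms(2) by (simp add: bounded_linear.continuous_on)
next
  case (Suc n)
  show ?case
    by (rule Ck_on_SucI[OF assms(1) bounded_linear.has_derivative
          [OF assms(2) Ck_on_SucD[OF Suc.prems]]])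
      (use Suc in auto)
qed

section \<open>Vector-valued functions via their components\<close>

lemma bounded_linear_axis: "bounded_linear (axis i :: 'a::real_normed_vector \<Rightarrow> 'a ^ 'n)"
proof (rule bounded_linear_intro[where K = 1])
  fix x y :: 'a and r :: real
  show "axis i (x + y) = (axis i x + axis i y :: 'a ^ 'n)"
    and "axis i (r *\<^sub>R x) = (r *\<^sub>R axis i x :: 'a ^ 'n)"
    by (simp_all add: vec_eq_iff axis_def)
  have "(norm ((axis i x :: 'a ^ 'n) $ j))\<^sup>2 = (if j = i then (norm x)\<^sup>2 else 0)" for j
    by (simp add: axis_def)
  then show "norm (axis i x :: 'a ^ 'n) \<le> norm x * 1"
    by (simp add: norm_vec_def L2_set_def)
qed

lemma Ck_on_vec:
  fixes f :: "'a::real_normed_vector \<Rightarrow> 'b::real_normed_vector ^ 'n"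
  assumes "open X" "\<And>i. Ck_on n (\<lambda>x. f x $ i) X"
  shows "Ck_on n f X"
proof -
  have "Ck_on n (\<lambda>x. \<Sum>i\<in>UNIV. axis i (f x $ i)) X"
    by (rule Ck_on_sum[OF assms(1)], rule Ck_on_compose_bounded_linear_left
        [OF assms(1) bounded_linear_axis assms(2)])
  moreover have "(\<Sum>i\<in>UNIV. axis i (f x $ i)) = f x" for x
    by (simp add: vec_eq_iff axis_def)
  ultimately show ?thesis by simp
qed

section \<open>Partial derivatives on the thermodynamic domain\<close>

text \<open>Chain rule along the line r \<mapsto> (r, \<theta>). It links the one-variable
  \<open>deriv\<close> in \<open>d_rho\<close> to the directional derivatives that
  \<open>Ck_on\<close> controls.\<close>

lemma d_rho_eq_frechet_derivative:
  assumes "f differentiable (at z)"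
  shows "d_rho f z = frechet_derivative f (at z) (1, 0)"
proof -
  obtain \<rho> \<theta> where z: "z = (\<rho>, \<theta>)" by (cases z)
  define f' where "f' = frechet_derivative f (at z)"
  have f': "(f has_derivative f') (at z)"
    using assms by (simp add: f'_def frechet_derivative_works)
  have "((\<lambda>r. (r, \<theta>)) has_derivative (\<lambda>h. (h, 0))) (at \<rho>)"
    by (auto intro!: derivative_eq_intros)
  then have "((\<lambda>r. f (r, \<theta>)) has_derivative (\<lambda>h. f' (h, 0))) (at \<rho>)"
    by (rule has_derivative_compose) (use f' z in simp)
  \<comment> \<open>A linear map on the reals is multiplication by its value at 1.\<close>
  moreover have "(\<lambda>h. f' (h, 0)) = (*) (f' (1, 0))"
  proof
    show "f' (h, 0) = f' (1, 0) * h" for h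
      using linear_scale[OF has_derivative_linear[OF f'], of h "(1, 0)"] by simp
  qed
  ultimately have "((\<lambda>r. f (r, \<theta>)) has_field_derivative f' (1, 0)) (at \<rho>)"
    by (simp add: has_field_derivative_def)
  then show ?thesis
    by (simp add: z d_rho_def DERIV_imp_deriv f'_def)
qed

lemma open_thermo_domain: "open thermo_domain"
proof -
  have "thermo_domain = {0<..} \<times> {0<..}"
    by (auto simp: thermo_domain_def)
  then show ?thesis
    using open_Times[OF open_greaterThan open_greaterThan, of "0::real" "0::real"] by (rule ssubst)
qed

lemma Ck_on_d_rho:
  assumes "smooth_on f thermo_domain"
  shows "Ck_on n (d_rho f) thermo_domain"
proof -
  have f: "Ck_on (Suc n) f thermo_domain"
    using assms by (simp add: smooth_on_def)
  then have "Ck_on n (\<lambda>z. frechet_derivative f (at z) (1, 0)) thermo_domain"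
    by simp
  then show ?thesis
    by (rule Ck_on_cong[OF open_thermo_domain, rotated])
      (use f in \<open>simp add: d_rho_eq_frechet_derivative\<close>)
qed

section \<open>Explicit \<open>4 \<times> 4\<close> matrices\<close>

lemma vector_4 [simp]:
  "(vector [x, y, z, w] :: 'a::zero ^ 4) $ 1 = x"
  "(vector [x, y, z, w] :: 'a::zero ^ 4) $ 2 = y"
  "(vector [x, y, z, w] :: 'a::zero ^ 4) $ 3 = z"
  "(vector [x, y, z, w] :: 'a::zero ^ 4) $ 4 = w"
  unfolding vector_def by simp_all

lemma symmetric_matrix_4_iff:
  "symmetric_matrix (M :: real^4^4) \<longleftrightarrow>
     M$1$2 = M$2$1 \<and> M$1$3 = M$3$1 \<and> M$1$4 = M$4$1 \<and>
     M$2$3 = M$3$2 \<and> M$2$4 = M$4$2 \<and> M$3$4 = M$4$3"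
  unfolding symmetric_matrix_def transpose_def vec_eq_iff forall_4 vec_lambda_beta by argo

text \<open>The quadratic form is the sum of \<open>M$i$i * (x$i)\<^sup>2\<close>; its terms are
  nonnegative, and one with \<open>x$k \<noteq> 0\<close> is positive.\<close>

lemma positive_definite_diagonal:
  fixes M :: "real^'n^'n"
  assumes "\<And>i. M$i$i > 0" "\<And>i j. i \<noteq> j \<Longrightarrow> M$i$j = 0"
  shows "positive_definite M"
  unfolding positive_definite_def
proof (intro allI impI)
  fix x :: "real^'n" assume "x \<noteq> 0"
  then obtain k where "x$k \<noteq> 0" by (auto simp: vec_eq_iff)
  have "(M *v x) $ i = M$i$i * x$i" for i
  proof -
    have "(M *v x) $ i = (\<Sum>j\<in>UNIV. if j = i then M$i$j * x$j else 0)"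
      unfolding matrix_vector_mult_def vec_lambda_beta
      by (rule sum.cong) (use assms(2)[of i] in auto)
    then show ?thesis by simp
  qed
  then have "x \<bullet> (M *v x) = (\<Sum>i\<in>UNIV. M$i$i * (x$i)\<^sup>2)"
    by (simp add: inner_vec_def power2_eq_square ac_simps)
  also have "\<dots> > 0"
    by (rule sum_pos2[of _ k])
      (use \<open>x$k \<noteq> 0\<close> assms(1) in \<open>auto intro!: mult_nonneg_nonneg less_imp_le[OF assms(1)]\<close>)
  finally show "0 < x \<bullet> (M *v x)" .
qed

section \<open>The Cattaneo-Christov system\<close>

lemma states_cattaneo_christov:
  "states (cattaneo_christov \<tau> p e lam \<mu> \<kappa>) = {U. U $ 1 > 0 \<and> U $ 3 > 0}"
  by (simp add: cattaneo_christov_def Let_def)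

text \<open>The source term is linear in \<open>U\<close>, so it is its own derivative, and the
  Jacobian is its matrix.\<close>

lemma Dmat_cattaneo_christov:
  "Dmat (cattaneo_christov \<tau> p e lam \<mu> \<kappa>) U $ i $ j = (if i = 4 \<and> j = 4 then - 1 else 0)"
proof -
  have "bounded_linear (\<lambda>U::real^4. vector [0, 0, 0, - (U $ 4)] :: real^4)"
  proof -
    \<comment> \<open>This form shows the map as a composition of bounded linear maps.\<close>
    have "(\<lambda>U. vector [0, 0, 0, - (U $ 4)] :: real^4) = (\<lambda>U::real^4. axis 4 (- (U $ 4)))"
      by (simp add: fun_eq_iff vec_eq_iff forall_4 axis_def)
    then show ?thesis
      by (simp add: bounded_linear_compose[OF bounded_linear_axis
          bounded_linear_minus[OF bounded_linear_vec_nth]])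
  qed
  then have "frechet_derivative (\<lambda>U. vector [0, 0, 0, - (U $ 4)] :: real^4) (at U) =
      (\<lambda>U. vector [0, 0, 0, - (U $ 4)])"
    by (intro frechet_derivative_eqI bounded_linear_imp_has_derivative)
  then have "Dmat (cattaneo_christov \<tau> p e lam \<mu> \<kappa>) U =
      matrix (\<lambda>U. vector [0, 0, 0, - (U $ 4)])"
    by (simp add: Dmat_def cattaneo_christov_def Let_def jacobian_def)
  then show ?thesis
    using exhaust_4[of i] by (elim disjE) (simp_all add: matrix_def axis_def)
qed

lemma smooth_on_cc_symmetrizer:
  assumes "smooth_on p thermo_domain" "smooth_on \<kappa> thermo_domain"
    and "\<And>z. z \<in> thermo_domain \<Longrightarrow> \<kappa> z > 0"
  shows "smooth_on (cc_symmetrizer p \<kappa>) {U. U $ 1 > 0 \<and> U $ 3 > 0}"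
    (is "smooth_on _ ?X")
  unfolding smooth_on_def
proof
  fix n
  have X: "open ?X"
    by (intro open_Collect_conj open_Collect_less continuous_intros)
  have proj: "bounded_linear (\<lambda>U::real^4. (U $ 1, U $ 3))"
    by (intro bounded_linear_Pair bounded_linear_vec_nth)
  have sub: "(\<lambda>U::real^4. (U $ 1, U $ 3)) ` ?X \<subseteq> thermo_domain"
    by (auto simp: thermo_domain_def)
  note lift = Ck_on_compose_bounded_linear[OF X proj sub]
  have nth: "Ck_on n (\<lambda>U::real^4. U $ k) ?X" for k
    by (rule Ck_on_bounded_linear[OF X bounded_linear_vec_nth])
  have "Ck_on n (\<lambda>U. d_rho p (U $ 1, U $ 3) / U $ 1) ?X"
    by (rule Ck_on_divide[OF X _ lift[OF Ck_on_d_rho[OF assms(1)]] nth]) auto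
  moreover have "Ck_on n (\<lambda>U::real^4. 1 / U $ 3) ?X"
    by (rule Ck_on_divide[OF X _ Ck_on_const[OF X] nth]) auto
  moreover have "Ck_on n (\<lambda>U. 1 / (\<kappa> (U $ 1, U $ 3) * U $ 3)) ?X"
  proof (intro Ck_on_divide[OF X] Ck_on_const[OF X] Ck_on_mult[OF X] nth lift)
    show "Ck_on n \<kappa> thermo_domain"
      using assms(2) by (simp add: smooth_on_def)
    show "\<kappa> (U $ 1, U $ 3) * U $ 3 \<noteq> 0" if "U \<in> ?X" for U
      using assms(3)[of "(U $ 1, U $ 3)"] that by (simp add: thermo_domain_def)
  qed
  \<comment> \<open>The entries not treated above are the constants 0 and 1. A matrix is a vector of
    rows, so \<open>Ck_on_vec\<close> is then applied twice.\<close>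
  ultimately have "\<forall>i j. Ck_on n (\<lambda>U. cc_symmetrizer p \<kappa> U $ i $ j) ?X"
    by (simp add: forall_4 cc_symmetrizer_def Let_def Ck_on_const[OF X])
  then show "Ck_on n (cc_symmetrizer p \<kappa>) ?X"
    by (intro Ck_on_vec X) simp
qed

theorem lemma3p4:
  fixes \<tau> :: real
    and p e lam \<mu> \<kappa> :: "real \<times> real \<Rightarrow> real"
  assumes "\<tau> > 0"
    and "smooth_on p thermo_domain"
    and "smooth_on e thermo_domain"
    and "smooth_on lam thermo_domain"
    and "smooth_on \<mu> thermo_domain"
    and "smooth_on \<kappa> thermo_domain"
    and "\<And>z. z \<in> thermo_domain \<Longrightarrow> \<mu> z \<ge> 0"
    and "\<And>z. z \<in> thermo_domain \<Longrightarrow> 2 / 3 * \<mu> z + lam z \<ge> 0"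
    and "\<And>z. z \<in> thermo_domain \<Longrightarrow> \<kappa> z > 0"
    and "\<And>z. z \<in> thermo_domain \<Longrightarrow> p z > 0"
    and "\<And>z. z \<in> thermo_domain \<Longrightarrow> d_rho p z > 0"
    and "\<And>z. z \<in> thermo_domain \<Longrightarrow> d_theta p z > 0"
    and "\<And>z. z \<in> thermo_domain \<Longrightarrow> d_theta e z > 0"
  shows "symmetrizable (cattaneo_christov \<tau> p e lam \<mu> \<kappa>)
       \<and> is_symmetrizer (cattaneo_christov \<tau> p e lam \<mu> \<kappa>) (cc_symmetrizer p \<kappa>)"
proof -
  let ?sys = "cattaneo_christov \<tau> p e lam \<mu> \<kappa>"
  let ?S = "cc_symmetrizer p \<kappa>"
  have "is_symmetrizer ?sys ?S"
    unfolding is_symmetrizer_def states_cattaneo_christov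
  proof (intro conjI ballI)
    show "smooth_on ?S {U. U $ 1 > 0 \<and> U $ 3 > 0}"
      using assms(2,6,9) by (rule smooth_on_cc_symmetrizer)
  next
    fix U :: "real^4" assume "U \<in> {U. U $ 1 > 0 \<and> U $ 3 > 0}"
    then have pos: "U $ 1 > 0" "U $ 3 > 0" by auto
    then have "(U $ 1, U $ 3) \<in> thermo_domain" by (simp add: thermo_domain_def)
    then have \<kappa>: "\<kappa> (U $ 1, U $ 3) > 0" and p: "d_rho p (U $ 1, U $ 3) > 0"
      using assms(9,11) by auto
    note S = cc_symmetrizer_def Let_def
    note sym = symmetric_matrix_4_iff matrix_matrix_mult_def sum_4
    show "symmetric_matrix (?S U)"
      by (simp add: S sym)
    show "positive_definite (?S U)"
    proof (rule positive_definite_diagonal)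
      have "\<forall>i. ?S U $ i $ i > 0"
        using pos \<kappa> p by (simp add: S forall_4)
      then show "?S U $ i $ i > 0" for i by blast
      have "\<forall>i j. i \<noteq> j \<longrightarrow> ?S U $ i $ j = 0"
        by (simp add: S forall_4)
      then show "?S U $ i $ j = 0" if "i \<noteq> j" for i j using that by blast
    qed
    show "symmetric_matrix (?S U ** A0mat ?sys U)"
      by (simp add: S sym cattaneo_christov_def)
    show "symmetric_matrix (?S U ** A1mat ?sys U)"
      \<comment> \<open>Nonvanishing of \<rho>, \<theta> and \<kappa> permits the cancellations
        (p_rho/\<rho>)\<rho> = p_rho, (1/\<theta>)\<theta> p_theta = p_theta and
        \<kappa>/(\<kappa>\<theta>) = 1/\<theta>.\<close>
      using pos \<kappa> by (simp add: S sym cattaneo_christov_def)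
    show "symmetric_matrix (?S U ** Bmat ?sys U)"
      by (simp add: S sym cattaneo_christov_def)
    show "symmetric_matrix (?S U ** Dmat ?sys U)"
      by (simp add: S sym Dmat_cattaneo_christov)
  qed
  then show ?thesis by (auto simp: symmetrizable_def)
qed

end
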